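(* Let $n, k$ be integers with $n > 4$ and $1 \leq k < \frac{n}{2}$, and let $\Gamma = K(n,k)$ be the Kneser graph. Then $\mathrm{Aut}(\Gamma) \cong \mathrm{Sym}([n])$.
   Context: For a positive integer $n$, $[n] = \{1, 2, \dots, n\}$. The Kneser graph $K(n,k)$ is the finite simple undirected graph whose vertex set is the set of all $k$-subsets of $[n]$, two vertices $v, w$ being adjacent if and only if $v \cap w = \varnothing$. $\mathrm{Aut}(\Gamma)$ denotes the group of graph automorphisms of $\Gamma$ under composition, and $\mathrm{Sym}([n])$ is the group of all permutations of $[n]$. *)

theory Defs
  imports "HOL-Algebra.Sym_Groups" "Graph_Theory.Pair_Digraph"
begin

text \<open>As usual in \<^theory>\<open>Graph_Theory.Pair_Digraph\<close>, a finite simple undirected graph is a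
  finite loop-free symmetric digraph (\<^locale>\<open>pair_graph\<close>): an edge is represented by its
  two opposite arcs. For \<open>k = 0\<close> the definition below would have a loop at the empty set;
  for \<open>k \<ge> 1\<close> it is a simple graph, see \<open>pair_graph_kneser\<close>.\<close>

definition kneser_graph :: "nat \<Rightarrow> nat \<Rightarrow> nat set pair_pre_digraph" where
  "kneser_graph n k =
     (let V = {v. v \<subseteq> {1..n} \<and> card v = k}
      in \<lparr> pverts = V, parcs = {(v, w). v \<in> V \<and> w \<in> V \<and> v \<inter> w = {}} \<rparr>)"

text \<open>\<open>p permutes V\<close> means that \<open>p\<close> is a bijection which is the identity outside \<open>V\<close>. Hence each
  automorphism of a graph is represented by exactly one function, and the group operation is plain
  composition, as for \<^const>\<open>sym_group\<close>.\<close>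

definition graph_automorphism :: "'a pair_pre_digraph \<Rightarrow> ('a \<Rightarrow> 'a) \<Rightarrow> bool" where
  "graph_automorphism G p \<longleftrightarrow>
     p permutes pverts G \<and>
     (\<forall>v\<in>pverts G. \<forall>w\<in>pverts G. (p v, p w) \<in> parcs G \<longleftrightarrow> (v, w) \<in> parcs G)"

definition Aut :: "'a pair_pre_digraph \<Rightarrow> ('a \<Rightarrow> 'a) monoid" where
  "Aut G = \<lparr> carrier = {p. graph_automorphism G p}, mult = (\<circ>), one = id \<rparr>"

lemma pair_graph_kneser:
  assumes "1 \<le> k"
  shows "pair_graph (kneser_graph n k)"
proof -
  let ?V = "{v. v \<subseteq> {1..n} \<and> card v = k}"
  let ?E = "{(v, w). v \<in> ?V \<and> w \<in> ?V \<and> v \<inter> w = {}}"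
  have G: "kneser_graph n k = \<lparr> pverts = ?V, parcs = ?E \<rparr>"
    by (simp add: kneser_graph_def Let_def)
  have fin: "finite ?V"
    by simp
  have finE: "finite ?E"
    by (rule finite_subset[OF _ finite_cartesian_product[OF fin fin]]) auto
  have ends: "arcs_ends (with_proj (kneser_graph n k)) = ?E"
    by (auto simp: G with_proj_def arcs_ends_def arc_to_ends_def image_def)
  have sym: "symmetric (with_proj (kneser_graph n k))"
    unfolding symmetric_def ends by (auto simp: sym_def)
  have loopfree: "v \<noteq> {}" if "v \<in> ?V" for v
    using that assms by auto
  show ?thesis
  proof
    show "finite (pverts (kneser_graph n k))" "finite (parcs (kneser_graph n k))"
      using fin finE by (simp_all only: G pair_pre_digraph.simps)
    show "symmetric (with_proj (kneser_graph n k))"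
      by (fact sym)
  next
    fix e assume "e \<in> parcs (kneser_graph n k)"
    then have e: "fst e \<in> ?V" "snd e \<in> ?V" "fst e \<inter> snd e = {}"
      by (auto simp: G)
    from e(1) show "fst e \<in> pverts (kneser_graph n k)"
      by (simp add: G)
    from e(2) show "snd e \<in> pverts (kneser_graph n k)"
      by (simp add: G)
    from e(3) loopfree[OF e(1)] show "fst e \<noteq> snd e"
      by auto
  qed
qed

lemma group_Aut: "group (Aut G)"
proof (rule groupI)
  fix p assume p: "p \<in> carrier (Aut G)"
  then have perm: "p permutes pverts G"
    by (simp add: Aut_def graph_automorphism_def)
  let ?q = "inv' p"
  have qV: "?q v \<in> pverts G" if "v \<in> pverts G" for v
    using permutes_in_image[OF permutes_inv[OF perm]] that by blast
  have "(?q v, ?q w) \<in> parcs G \<longleftrightarrow> (v, w) \<in> parcs G"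
    if "v \<in> pverts G" "w \<in> pverts G" for v w
    using p qV[OF that(1)] qV[OF that(2)] permutes_inverses(1)[OF perm]
    unfolding Aut_def graph_automorphism_def by fastforce
  then have "?q \<in> carrier (Aut G)"
    using permutes_inv[OF perm] by (simp add: Aut_def graph_automorphism_def)
  moreover have "?q \<otimes>\<^bsub>Aut G\<^esub> p = \<one>\<^bsub>Aut G\<^esub>"
    using permutes_inv_o(2)[OF perm] by (simp add: Aut_def)
  ultimately show "\<exists>q\<in>carrier (Aut G). q \<otimes>\<^bsub>Aut G\<^esub> p = \<one>\<^bsub>Aut G\<^esub>"
    by blast
next
  fix p q assume "p \<in> carrier (Aut G)" "q \<in> carrier (Aut G)"
  then show "p \<otimes>\<^bsub>Aut G\<^esub> q \<in> carrier (Aut G)"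
    by (simp add: Aut_def graph_automorphism_def permutes_compose permutes_in_image)
qed (simp_all add: Aut_def graph_automorphism_def permutes_id comp_assoc)

end

theory Submission
  imports Defs
begin

text \<open>Every permutation of \<open>[n]\<close> acts on the \<open>k\<close>-subsets of \<open>[n]\<close> and preserves disjointness. The
  resulting homomorphism from the symmetric group is injective because \<open>1 \<le> k < n\<close>: distinct points
  are separated by \<open>k\<close>-subsets. The substance of the theorem is that this homomorphism is
  surjective, i.e. that every automorphism \<open>f\<close> is induced by a permutation of the points.

  The usual proof identifies the maximum independent sets by the Erdos-Ko-Rado theorem. The proof
  below only counts common neighbours. The vertices of a set \<open>X\<close> have \<open>n - |\<Union>X|\<close> choose \<open>k\<close> common
  neighbours, and \<open>f\<close> preserves this number; so \<open>f\<close> preserves \<open>|\<Union>X|\<close> as long as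
  \<open>|\<Union>X| \<le> n - k\<close> (\<open>card_Union_image\<close>). As \<open>k + 1 \<le> n - k\<close>, it follows that \<open>f\<close> preserves the
  relation \<open>|v \<inter> w| = k - 1\<close> and also the property of three vertices to lie in a common
  \<open>(k + 1)\<close>-set. Of the three-element families of pairwise intersection size \<open>k - 1\<close>, those that do
  not lie in a \<open>(k + 1)\<close>-set are exactly the ones with a common \<open>(k - 1)\<close>-subset. Hence \<open>f\<close> maps the
  star of a \<open>(k - 1)\<close>-set \<open>A\<close>, the family of all vertices that contain \<open>A\<close>, into the star of another
  \<open>(k - 1)\<close>-set, the core of \<open>A\<close> (\<open>card_core\<close>).

  The map from \<open>A\<close> to its core is again an automorphism, now of the Kneser graph of the
  \<open>(k - 1)\<close>-subsets (\<open>kneser_automorphism_core\<close>). Descending to \<open>k = 1\<close>, where vertices are points,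
  gives a permutation \<open>p\<close>, and \<open>f v = p ` v\<close> carries over from each level to the one above since a
  set of at least two elements is the union of the subsets that omit one of them.\<close>

section \<open>Subsets of fixed size\<close>

definition ksets :: "'a set \<Rightarrow> nat \<Rightarrow> 'a set set" where
  "ksets S k = {v. v \<subseteq> S \<and> card v = k}"

lemma ksetsI: "v \<subseteq> S \<Longrightarrow> card v = k \<Longrightarrow> v \<in> ksets S k"
  by (simp add: ksets_def)

lemma ksetsD:
  assumes "v \<in> ksets S k"
  shows "v \<subseteq> S" "card v = k"
  using assms by (simp_all add: ksets_def)

lemma finite_ksetsD: "finite S \<Longrightarrow> v \<in> ksets S k \<Longrightarrow> finite v"
  by (auto simp: ksets_def dest: finite_subset)

lemma insert_in_ksets:
  assumes "finite S" "A \<in> ksets S j" "a \<in> S - A"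
  shows "insert a A \<in> ksets S (Suc j)"
  using assms finite_ksetsD[OF assms(1,2)] by (auto simp: ksets_def)

lemma permutes_image_ksets:
  assumes "p permutes S" "v \<in> ksets S k"
  shows "p ` v \<in> ksets S k"
proof (rule ksetsI)
  show "p ` v \<subseteq> S"
    using ksetsD(1)[OF assms(2)] permutes_in_image[OF assms(1)] by auto
  show "card (p ` v) = k"
    using ksetsD(2)[OF assms(2)] permutes_inj_on[OF assms(1)] by (simp add: card_image)
qed

lemma binomial_less_binomial:
  assumes "a < b" "1 \<le> k" "k \<le> b"
  shows "a choose k < b choose k"
proof -
  obtain c where c: "b = Suc c" "a \<le> c"
    using assms(1) by (cases b) auto
  obtain i where i: "k = Suc i"
    using assms(2) by (cases k) auto
  have "a choose k \<le> c choose k"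
    using c(2) by (rule binomial_right_mono)
  also have "\<dots> < b choose k"
    using assms(3) c(1) i by simp
  finally show ?thesis .
qed

section \<open>Counting common neighbours\<close>

text \<open>An automorphism of the Kneser graph is carried together with its inverse, so that every lemma
  about \<open>f\<close> is also available for \<open>g\<close>.\<close>

locale kneser_automorphism =
  fixes S :: "'a set" and k :: nat and f g :: "'a set \<Rightarrow> 'a set"
  assumes finite_S: "finite S"
    and two_k_less: "2 * k < card S"
    and f_ksets: "v \<in> ksets S k \<Longrightarrow> f v \<in> ksets S k"
    and g_ksets: "v \<in> ksets S k \<Longrightarrow> g v \<in> ksets S k"
    and g_f: "v \<in> ksets S k \<Longrightarrow> g (f v) = v"
    and f_g: "v \<in> ksets S k \<Longrightarrow> f (g v) = v"
    and f_disjoint_iff: "v \<in> ksets S k \<Longrightarrow> w \<in> ksets S k \<Longrightarrow> f v \<inter> f w = {} \<longleftrightarrow> v \<inter> w = {}"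
begin

lemma inverse: "kneser_automorphism S k g f"
proof
  fix v w assume vw: "v \<in> ksets S k" "w \<in> ksets S k"
  show "g v \<inter> g w = {} \<longleftrightarrow> v \<inter> w = {}"
    using f_disjoint_iff[OF vw[THEN g_ksets]] by (simp add: vw f_g)
qed (simp_all add: finite_S two_k_less f_ksets g_ksets g_f f_g)

definition common_neighbours :: "'a set set \<Rightarrow> 'a set set" where
  "common_neighbours X = {w \<in> ksets S k. \<forall>v\<in>X. v \<inter> w = {}}"

lemma card_common_neighbours:
  assumes "X \<subseteq> ksets S k"
  shows "card (common_neighbours X) = (card S - card (\<Union>X)) choose k"
proof -
  have sub: "\<Union>X \<subseteq> S"
    using assms by (auto simp: ksets_def)
  have "common_neighbours X = {w. w \<subseteq> S - \<Union>X \<and> card w = k}"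
    by (auto simp: common_neighbours_def ksets_def)
  then show ?thesis
    using sub finite_S by (simp add: n_subsets card_Diff_subset finite_subset)
qed

lemma bij_betw_common_neighbours:
  assumes "X \<subseteq> ksets S k"
  shows "bij_betw f (common_neighbours X) (common_neighbours (f ` X))"
proof (rule bij_betw_byWitness[where f' = g])
  show "\<forall>w\<in>common_neighbours X. g (f w) = w"
    by (simp add: common_neighbours_def g_f)
  show "\<forall>w\<in>common_neighbours (f ` X). f (g w) = w"
    by (simp add: common_neighbours_def f_g)
  show "f ` common_neighbours X \<subseteq> common_neighbours (f ` X)"
  proof
    fix u assume "u \<in> f ` common_neighbours X"
    then obtain w where w: "w \<in> ksets S k" "u = f w" "\<forall>v\<in>X. v \<inter> w = {}"
      by (auto simp: common_neighbours_def)
    have "f v \<inter> u = {}" if "v \<in> X" for v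
      using that w assms f_disjoint_iff[of v w] by auto
    then show "u \<in> common_neighbours (f ` X)"
      using w by (simp add: common_neighbours_def f_ksets)
  qed
  show "g ` common_neighbours (f ` X) \<subseteq> common_neighbours X"
  proof
    fix u assume "u \<in> g ` common_neighbours (f ` X)"
    then obtain w where w: "w \<in> ksets S k" "u = g w" "\<forall>v\<in>X. f v \<inter> w = {}"
      by (auto simp: common_neighbours_def)
    have "v \<inter> u = {}" if "v \<in> X" for v
      using that w assms f_disjoint_iff[of v u] by (auto simp: g_ksets f_g)
    then show "u \<in> common_neighbours X"
      using w by (simp add: common_neighbours_def g_ksets)
  qed
qed

text \<open>The bound on the size of the union says that there is a common neighbour. Without one, the
  number of common neighbours is \<open>0\<close> and no longer determines the size of the union.\<close>

lemma card_Union_image: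
  assumes "1 \<le> k" "X \<subseteq> ksets S k" "card (\<Union>X) + k \<le> card S"
  shows "card (\<Union>(f ` X)) = card (\<Union>X)"
proof -
  have fX: "f ` X \<subseteq> ksets S k"
    using assms(2) f_ksets by auto
  have le: "card (\<Union>(f ` X)) \<le> card S"
    using fX by (intro card_mono finite_S) (auto simp: ksets_def)
  have "(card S - card (\<Union>X)) choose k = (card S - card (\<Union>(f ` X))) choose k"
    using bij_betw_same_card[OF bij_betw_common_neighbours[OF assms(2)]]
    by (simp add: card_common_neighbours assms(2) fX)
  moreover have "a = b" if "k \<le> a" "a choose k = b choose k" for a b
    using that binomial_less_binomial[OF _ assms(1), of a b]
      binomial_less_binomial[OF _ assms(1), of b a]
    by (cases a b rule: linorder_cases) simp_all
  moreover have "k \<le> card S - card (\<Union>X)"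
    using assms(3) by simp
  ultimately have "card S - card (\<Union>X) = card S - card (\<Union>(f ` X))"
    by blast
  then show ?thesis
    using le assms(3) by simp
qed

end

section \<open>Stars and their cores\<close>

definition star :: "'a set \<Rightarrow> 'a set \<Rightarrow> 'a set set" where
  "star S A = {insert a A |a. a \<in> S - A}"

definition core :: "'a set \<Rightarrow> ('a set \<Rightarrow> 'a set) \<Rightarrow> 'a set \<Rightarrow> 'a set" where
  "core S f A = \<Inter>(f ` star S A)"

lemma star_subset_ksets:
  assumes "finite S" "A \<in> ksets S j"
  shows "star S A \<subseteq> ksets S (Suc j)"
  using insert_in_ksets[OF assms] by (auto simp: star_def)

lemma star_memI:
  assumes "finite S" "A \<in> ksets S j" "v \<in> ksets S (Suc j)" "A \<subseteq> v"
  shows "v \<in> star S A"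
proof -
  have "finite v" "finite A"
    using assms finite_ksetsD by blast+
  then have "card (v - A) = 1"
    using assms by (simp add: card_Diff_subset ksets_def)
  then obtain a where "v - A = {a}"
    by (auto simp: card_1_singleton_iff)
  then have "v = insert a A" "a \<in> S - A"
    using assms ksetsD(1)[OF assms(3)] by auto
  then show ?thesis
    by (auto simp: star_def)
qed

lemma core_subset: "v \<in> star S A \<Longrightarrow> core S f A \<subseteq> f v"
  by (auto simp: core_def)

lemma obtain_two_outside:
  assumes "finite S" "A \<subseteq> S" "card A + 2 \<le> card S"
  obtains a b where "a \<in> S - A" "b \<in> S - A" "a \<noteq> b"
proof -
  have "2 \<le> card (S - A)"
    using assms by (simp add: card_Diff_subset finite_subset)
  then have "\<not> card (S - A) \<le> Suc 0"
    by simp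
  then show ?thesis
    using that card_le_Suc0_iff_eq[of "S - A"] assms(1) by blast
qed

text \<open>If \<open>w\<close> misses a point \<open>b\<close> of \<open>u \<inter> v\<close>, then its intersections with \<open>u\<close> and \<open>v\<close> are too large to
  miss anything else, and \<open>(u \<union> v) - {b}\<close> is already as large as \<open>w\<close>.\<close>

lemma triangle_in_Union:
  assumes fin: "finite u" "finite v" "finite w"
    and card: "card u = Suc j" "card v = Suc j" "card w = Suc j"
    and inter: "card (u \<inter> v) = j" "card (u \<inter> w) = j" "card (v \<inter> w) = j"
    and not_sub: "\<not> u \<inter> v \<subseteq> w"
  shows "w \<subseteq> u \<union> v"
proof -
  obtain b where b: "b \<in> u" "b \<in> v" "b \<notin> w"
    using not_sub by auto
  have "u \<inter> w = u - {b}"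
    by (rule card_subset_eq) (use fin card inter b in auto)
  moreover have "v \<inter> w = v - {b}"
    by (rule card_subset_eq) (use fin card inter b in auto)
  ultimately have sub: "(u \<union> v) - {b} \<subseteq> w"
    by auto
  have "card (u \<union> v) = Suc (Suc j)"
    using card_Un_Int[OF fin(1,2)] card inter by simp
  then have "card ((u \<union> v) - {b}) = card w"
    using b card fin by simp
  then have "(u \<union> v) - {b} = w"
    using card_subset_eq[OF fin(3) sub] by simp
  then show ?thesis
    by auto
qed

context kneser_automorphism
begin

text \<open>Two members of the star of \<open>A\<close> have images that meet in \<open>j\<close> points. These \<open>j\<close> points also lie in
  the image of any third member: otherwise the three images would lie in a common \<open>(k + 1)\<close>-set, and
  \<open>g\<close> would carry this property back to the star.\<close>

lemma card_core:
  assumes k: "k = Suc j" and A: "A \<in> ksets S j"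
  shows "card (core S f A) = j"
proof -
  interpret inv: kneser_automorphism S k g f
    by (rule inverse)
  have finA: "finite A" and cardA: "card A = j"
    using A finite_ksetsD finite_S by (auto simp: ksets_def)
  have ins: "insert a A \<in> ksets S k" if "a \<in> S - A" for a
    using insert_in_ksets[OF finite_S A that] k by simp
  have fins: "finite (f (insert a A))" "card (f (insert a A)) = Suc j" if "a \<in> S - A" for a
    using finite_ksetsD[OF finite_S f_ksets[OF ins[OF that]]] ksetsD(2)[OF f_ksets[OF ins[OF that]]] k
    by simp_all
  have card_Un: "card (f (insert a A) \<union> f (insert b A)) = Suc (Suc j)"
    if "a \<in> S - A" "b \<in> S - A" "a \<noteq> b" for a b
    using card_Union_image[of "{insert a A, insert b A}"] that ins finA cardA k two_k_less
    by (simp add: insert_commute)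
  have card_Int: "card (f (insert a A) \<inter> f (insert b A)) = j"
    if "a \<in> S - A" "b \<in> S - A" "a \<noteq> b" for a b
    using card_Un_Int[OF fins(1)[OF that(1)] fins(1)[OF that(2)]] card_Un[OF that] fins that
    by simp
  obtain a b where ab: "a \<in> S - A" "b \<in> S - A" "a \<noteq> b"
    using obtain_two_outside[OF finite_S ksetsD(1)[OF A]] cardA k two_k_less by auto
  let ?u = "insert a A" and ?v = "insert b A"
  have sub: "f ?u \<inter> f ?v \<subseteq> f (insert c A)" if c: "c \<in> S - A" for c
  proof (rule ccontr)
    let ?w = "insert c A"
    assume not_sub: "\<not> f ?u \<inter> f ?v \<subseteq> f ?w"
    then have ne: "a \<noteq> c" "b \<noteq> c"
      by auto
    have "f ?w \<subseteq> f ?u \<union> f ?v"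
      by (rule triangle_in_Union[OF _ _ _ _ _ _ _ _ _ not_sub])
        (use fins card_Int ab c ne in auto)
    then have Un: "f ?u \<union> (f ?v \<union> f ?w) = f ?u \<union> f ?v"
      by auto
    \<comment> \<open>The images lie in a common set of size \<open>k + 1\<close>, hence so do the preimages, which however
      contain \<open>A\<close> and three further points.\<close>
    have "card (?u \<union> (?v \<union> ?w)) = Suc (Suc j)"
      using inv.card_Union_image[of "{f ?u, f ?v, f ?w}"] card_Un[OF ab] ab c ins f_ksets g_f k
        two_k_less
      by (simp add: Un)
    moreover have "?u \<union> (?v \<union> ?w) = insert a (insert b (insert c A))"
      by auto
    ultimately show False
      using ab c ne finA cardA by simp
  qed
  have "core S f A = f ?u \<inter> f ?v"
    using sub ab by (auto simp: core_def star_def)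
  then show ?thesis
    using card_Int[OF ab] by simp
qed

lemma core_ksets:
  assumes "k = Suc j" "A \<in> ksets S j"
  shows "core S f A \<in> ksets S j"
proof (rule ksetsI)
  have "card A < card S"
    using assms two_k_less by (simp add: ksets_def)
  then obtain a where "a \<in> S - A"
    using ksetsD(1)[OF assms(2)] by (metis Diff_eq_empty_iff equals0I less_irrefl subset_antisym)
  then have "insert a A \<in> star S A" "insert a A \<in> ksets S k"
    using insert_in_ksets[OF finite_S assms(2)] assms(1) by (auto simp: star_def)
  then show "core S f A \<subseteq> S"
    using core_subset f_ksets ksetsD(1) by blast
qed (rule card_core[OF assms])

lemma image_star_subset:
  assumes "k = Suc j" "A \<in> ksets S j"
  shows "f ` star S A \<subseteq> star S (core S f A)"
proof
  fix w assume "w \<in> f ` star S A"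
  then obtain v where v: "w = f v" "v \<in> star S A"
    by auto
  then have "v \<in> ksets S k"
    using star_subset_ksets[OF finite_S assms(2)] assms(1) by auto
  then show "w \<in> star S (core S f A)"
    using v star_memI[OF finite_S core_ksets[OF assms]] f_ksets core_subset[OF v(2)] assms(1)
    by simp
qed

text \<open>For every \<open>v\<close> in the star of \<open>A\<close>, \<open>f v\<close> is in the star of the core, so \<open>v = g (f v)\<close> contains
  the core of the core. The members of the star have only \<open>A\<close> in common, and the sizes agree.\<close>

lemma core_core:
  assumes k: "k = Suc j" and A: "A \<in> ksets S j"
  shows "core S g (core S f A) = A"
proof -
  interpret inv: kneser_automorphism S k g f
    by (rule inverse)
  have sub: "core S g (core S f A) \<subseteq> v" if "v \<in> star S A" for v
  proof -
    have "v \<in> ksets S k"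
      using that star_subset_ksets[OF finite_S A] k by auto
    then show ?thesis
      using core_subset[of "f v" S "core S f A" g] image_star_subset[OF k A] that
      by (auto simp: g_f)
  qed
  obtain a b where "a \<in> S - A" "b \<in> S - A" "a \<noteq> b"
    using obtain_two_outside[OF finite_S ksetsD(1)[OF A]] ksetsD(2)[OF A] k two_k_less by auto
  then have "core S g (core S f A) \<subseteq> insert a A \<inter> insert b A" "insert a A \<inter> insert b A = A"
    using sub by (auto simp: star_def)
  then have "core S g (core S f A) \<subseteq> A"
    by simp
  moreover have "card (core S g (core S f A)) = card A"
    using inv.core_ksets[OF k core_ksets[OF k A]] A by (simp add: ksets_def)
  ultimately show ?thesis
    using card_subset_eq finite_ksetsD[OF finite_S A] by blast
qed

text \<open>Disjoint sets of size \<open>k - 1\<close> extend to disjoint sets of size \<open>k\<close>, because \<open>S\<close> has at least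
  \<open>2 * k\<close> elements; the images of these are disjoint and contain the cores.\<close>

lemma core_disjoint:
  assumes k: "k = Suc j" and A: "A \<in> ksets S j" and B: "B \<in> ksets S j" and "A \<inter> B = {}"
  shows "core S f A \<inter> core S f B = {}"
proof -
  have "card (A \<union> B) \<le> 2 * j"
    using card_Un_le[of A B] A B by (simp add: ksets_def)
  then obtain a b where ab: "a \<in> S - (A \<union> B)" "b \<in> S - (A \<union> B)" "a \<noteq> b"
    using obtain_two_outside[OF finite_S, of "A \<union> B"] A B k two_k_less by (auto simp: ksets_def)
  have st: "insert a A \<in> star S A" "insert b B \<in> star S B"
    using ab by (auto simp: star_def)
  have "insert a A \<in> ksets S k" "insert b B \<in> ksets S k"
    using st star_subset_ksets[OF finite_S A] star_subset_ksets[OF finite_S B] k by auto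
  then have "f (insert a A) \<inter> f (insert b B) = {}"
    using ab assms(4) by (subst f_disjoint_iff) auto
  then show ?thesis
    using core_subset[OF st(1), of f] core_subset[OF st(2), of f] by blast
qed

lemma kneser_automorphism_core:
  assumes k: "k = Suc j"
  shows "kneser_automorphism S j (core S f) (core S g)"
proof -
  interpret inv: kneser_automorphism S k g f
    by (rule inverse)
  show ?thesis
  proof
    fix A B assume AB: "A \<in> ksets S j" "B \<in> ksets S j"
    show "core S f A \<inter> core S f B = {} \<longleftrightarrow> A \<inter> B = {}"
      using core_disjoint[OF k AB] inv.core_disjoint[OF k AB[THEN core_ksets[OF k]]]
      by (auto simp only: core_core[OF k] AB)
  qed (use k two_k_less in \<open>simp_all add: finite_S core_ksets inv.core_ksets core_core inv.core_core\<close>)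
qed

end

section \<open>Automorphisms are induced by permutations of the points\<close>

lemma (in kneser_automorphism) induced_by_permutation_singletons:
  assumes k: "k = 1"
  shows "\<exists>p. p permutes S \<and> (\<forall>v\<in>ksets S k. f v = p ` v)"
proof -
  have single: "v \<in> ksets S k \<longleftrightarrow> (\<exists>x\<in>S. v = {x})" for v
    using k by (auto simp: ksets_def card_1_singleton_iff)
  have "\<exists>q. \<forall>x\<in>S. q x \<in> S \<and> f {x} = {q x}"
    by (rule bchoice) (use f_ksets single in blast)
  then obtain q where q: "\<And>x. x \<in> S \<Longrightarrow> q x \<in> S \<and> f {x} = {q x}"
    by auto
  define p where "p = (\<lambda>x. if x \<in> S then q x else x)"
  have p: "p x \<in> S" "f {x} = {p x}" if "x \<in> S" for x
    using q that by (auto simp: p_def)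
  have "inj_on p S"
  proof (rule inj_onI)
    fix x y assume xy: "x \<in> S" "y \<in> S" "p x = p y"
    then have "g (f {x}) = g (f {y})"
      using p by simp
    then show "x = y"
      using xy single by (simp add: g_f)
  qed
  moreover have "p ` S = S"
    using p finite_S calculation by (intro endo_inj_surj) auto
  ultimately have "p permutes S"
    by (intro bij_imp_permutes) (auto simp: bij_betw_def p_def)
  then show ?thesis
    using p(2) single by (intro exI[of _ p]) auto
qed

theorem kneser_automorphism_induced_by_permutation:
  assumes "kneser_automorphism S (Suc j) f g"
  shows "\<exists>p. p permutes S \<and> (\<forall>v\<in>ksets S (Suc j). f v = p ` v)"
  using assms
proof (induction j arbitrary: f g)
  case 0
  then show ?case
    using kneser_automorphism.induced_by_permutation_singletons by fastforce
next
  case (Suc j)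
  then interpret kneser_automorphism S "Suc (Suc j)" f g
    by simp
  obtain p where p: "p permutes S" "\<And>A. A \<in> ksets S (Suc j) \<Longrightarrow> core S f A = p ` A"
    using Suc.IH[OF kneser_automorphism_core[OF refl]] by blast
  have "f v = p ` v" if v: "v \<in> ksets S (Suc (Suc j))" for v
  proof -
    have finv: "finite v"
      using finite_ksetsD[OF finite_S v] .
    have sub: "p ` (v - {x}) \<subseteq> f v" if x: "x \<in> v" for x
    proof -
      have vx: "v - {x} \<in> ksets S (Suc j)"
        using v x finv by (auto simp: ksets_def)
      show ?thesis
        using core_subset[OF star_memI[OF finite_S vx v], of f] p(2)[OF vx] by auto
    qed
    have "p ` v \<subseteq> f v"
    proof
      fix y assume "y \<in> p ` v"
      then obtain z where z: "z \<in> v" "y = p z"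
        by auto
      have "card (v - {z}) = Suc j"
        using z v finv by (simp add: ksets_def)
      then have "v - {z} \<noteq> {}"
        by (intro notI) simp
      then obtain x where "x \<in> v - {z}"
        by blast
      then show "y \<in> f v"
        using sub[of x] z by auto
    qed
    moreover have "card (p ` v) = card (f v)"
      using permutes_image_ksets[OF p(1) v] f_ksets[OF v] by (simp add: ksets_def)
    ultimately show ?thesis
      using card_subset_eq[OF finite_ksetsD[OF finite_S f_ksets[OF v]]] by metis
  qed
  then show ?case
    using p(1) by blast
qed

section \<open>The action of the symmetric group\<close>

lemma pverts_kneser: "pverts (kneser_graph n k) = ksets {1..n} k"
  by (simp add: kneser_graph_def ksets_def Let_def)

lemma parcs_kneser:
  "(v, w) \<in> parcs (kneser_graph n k) \<longleftrightarrow>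
     v \<in> ksets {1..n} k \<and> w \<in> ksets {1..n} k \<and> v \<inter> w = {}"
  by (simp add: kneser_graph_def ksets_def Let_def)

lemma graph_automorphism_kneser_iff:
  "graph_automorphism (kneser_graph n k) f \<longleftrightarrow>
     f permutes ksets {1..n} k \<and>
     (\<forall>v\<in>ksets {1..n} k. \<forall>w\<in>ksets {1..n} k. f v \<inter> f w = {} \<longleftrightarrow> v \<inter> w = {})"
  unfolding graph_automorphism_def pverts_kneser parcs_kneser
  by (auto simp: permutes_in_image)

text \<open>The identity away from the vertices makes this the representative of the automorphism that
  \<open>p\<close> induces.\<close>

definition set_action :: "nat \<Rightarrow> nat \<Rightarrow> (nat \<Rightarrow> nat) \<Rightarrow> nat set \<Rightarrow> nat set" where
  "set_action n k p v = (if v \<in> ksets {1..n} k then p ` v else v)"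

lemma set_action_comp:
  assumes "q permutes {1..n}"
  shows "set_action n k (p \<circ> q) = set_action n k p \<circ> set_action n k q"
  using permutes_image_ksets[OF assms] by (auto simp: set_action_def fun_eq_iff image_comp)

lemma set_action_id: "set_action n k id = id"
  by (auto simp: set_action_def fun_eq_iff)

lemma set_action_automorphism:
  assumes p: "p permutes {1..n}"
  shows "graph_automorphism (kneser_graph n k) (set_action n k p)"
  unfolding graph_automorphism_kneser_iff
proof (intro conjI ballI)
  let ?q = "inv' p"
  have q: "?q permutes {1..n}"
    using p by (rule permutes_inv)
  have "set_action n k p \<circ> set_action n k ?q = id" "set_action n k ?q \<circ> set_action n k p = id"
    using set_action_comp[OF q, of k p] set_action_comp[OF p, of k ?q] permutes_inv_o[OF p]
    by (simp_all add: set_action_id)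
  then have "bij (set_action n k p)"
    using o_bij by blast
  then show "set_action n k p permutes ksets {1..n} k"
    by (auto simp: permutes_def bij_iff set_action_def)
  fix v w assume "v \<in> ksets {1..n} k" "w \<in> ksets {1..n} k"
  then show "set_action n k p v \<inter> set_action n k p w = {} \<longleftrightarrow> v \<inter> w = {}"
    using image_Int[OF permutes_inj[OF p], of v w] by (simp add: set_action_def) blast
qed

lemma set_action_hom: "set_action n k \<in> hom (sym_group n) (Aut (kneser_graph n k))"
  by (rule homI)
    (simp_all add: sym_group_def Aut_def set_action_automorphism set_action_comp)

lemma inj_on_set_action:
  assumes "1 \<le> k" "k < n"
  shows "inj_on (set_action n k) {p. p permutes {1..n}}"
proof (rule inj_onI)
  fix p q assume "p \<in> {p. p permutes {1..n}}" "q \<in> {p. p permutes {1..n}}"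
  then have p: "p permutes {1..n}" and q: "q permutes {1..n}"
    by auto
  assume eq: "set_action n k p = set_action n k q"
  have "p x = q x" if x: "x \<in> {1..n}" for x
  proof (rule ccontr)
    assume ne: "p x \<noteq> q x"
    have "p x \<in> q ` {1..n}"
      using x by (simp only: permutes_image[OF q] permutes_in_image[OF p])
    then obtain y where y: "y \<in> {1..n}" "q y = p x"
      by auto
    have xy: "x \<noteq> y"
      using y ne by auto
    \<comment> \<open>A vertex that contains \<open>x\<close> but not \<open>y\<close>: its image under \<open>p\<close> contains \<open>p x = q y\<close>, its image
      under \<open>q\<close> does not.\<close>
    have "k - 1 \<le> card ({1..n} - {x, y})"
      using x y xy assms by (simp add: card_Diff_subset)
    then obtain T where T: "T \<subseteq> {1..n} - {x, y}" "card T = k - 1" "finite T"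
      by (rule obtain_subset_with_card_n)
    let ?v = "insert x T"
    have v: "?v \<in> ksets {1..n} k"
      using T x assms(1) by (auto simp: ksets_def card_insert_if)
    then have "p ` ?v = q ` ?v"
      using fun_cong[OF eq, of ?v] by (simp add: set_action_def)
    then have "q y \<in> q ` ?v"
      using y(2) by auto
    then have "y \<in> ?v"
      by (simp only: inj_image_mem_iff[OF permutes_inj[OF q]])
    then show False
      using T(1) xy by blast
  qed
  then have "p x = q x" for x
    using permutes_not_in[OF p] permutes_not_in[OF q] by (cases "x \<in> {1..n}") metis+
  then show "p = q"
    by (rule ext)
qed

lemma set_action_surj:
  assumes "1 \<le> k" "2 * k < n" "graph_automorphism (kneser_graph n k) f"
  shows "\<exists>p. p permutes {1..n} \<and> f = set_action n k p"
proof -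
  have f: "f permutes ksets {1..n} k"
    and disj: "\<And>v w. v \<in> ksets {1..n} k \<Longrightarrow> w \<in> ksets {1..n} k \<Longrightarrow>
      f v \<inter> f w = {} \<longleftrightarrow> v \<inter> w = {}"
    using assms(3) by (auto simp: graph_automorphism_kneser_iff)
  obtain j where j: "k = Suc j"
    using assms(1) by (cases k) auto
  have aut: "kneser_automorphism {1..n} (Suc j) f (inv' f)"
    unfolding j[symmetric]
  proof
    show "2 * k < card {1..n}"
      using assms(2) by simp
  qed (simp_all only: finite_atLeastAtMost disj permutes_in_image[OF f]
      permutes_in_image[OF permutes_inv[OF f]] permutes_inverses[OF f])
  obtain p where p: "p permutes {1..n}" "\<And>v. v \<in> ksets {1..n} k \<Longrightarrow> f v = p ` v"
    using kneser_automorphism_induced_by_permutation[OF aut, folded j] by blast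
  have "f = set_action n k p"
    using p(2) permutes_not_in[OF f] by (auto simp: set_action_def fun_eq_iff)
  then show ?thesis
    using p(1) by blast
qed

theorem theorem3p7:
  fixes n k :: nat
  assumes "n > 4" and "1 \<le> k" and "real k < real n / 2"
  shows "Aut (kneser_graph n k) \<cong> sym_group n"
proof -
  have k: "2 * k < n" "k < n"
    using assms by linarith+
  have "set_action n k ` {p. p permutes {1..n}} = {f. graph_automorphism (kneser_graph n k) f}"
    using set_action_automorphism set_action_surj[OF assms(2) k(1)] by blast
  then have "bij_betw (set_action n k) (carrier (sym_group n)) (carrier (Aut (kneser_graph n k)))"
    using inj_on_set_action[OF assms(2) k(2)]
    by (simp add: bij_betw_def sym_group_def Aut_def)
  then have "sym_group n \<cong> Aut (kneser_graph n k)"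
    using set_action_hom by (intro is_isoI[of "set_action n k"]) (simp add: iso_def)
  then show ?thesis
    by (rule group.iso_sym[OF sym_group_is_group])
qed

end
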